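(* Assume the PETC system (see context) is globally exponentially stable (GES), and that there is a known constant $a$ with $0\le a<1$ such that every solution of it satisfies $V(\xi(t_{i+1}))\le aV(\xi(t_i))$. Let $$T^*=h\max_{\sigma=k_1\cdots k_m\in\mathcal{X}^{\mathrm{S'}}}\ \sum_{i=1}^{m}k_i$$ be the duration of the longest (time-wise) sequence in $\mathcal{X}^{\mathrm{S'}}$. Then $b^*=-\log(r)/(2T^* )$ is an upper bound for the GES decay rate of the PETC system.
   Context: Plant and PETC. Let $A\in\mathbb{R}^{n_x\times n_x}$, $B\in\mathbb{R}^{n_x\times n_u}$, $K_{\mathrm{c}}\in\mathbb{R}^{n_u\times n_x}$, $h>0$, $\bar k\in\mathbb{N}$ ($\bar k\ge1$), and let $Q\in\mathbb{R}^{2n_x\times 2n_x}$ be symmetric. The plant is $\dot\xi(t)=A\xi(t)+BK_{\mathrm{c}}\hat\xi(t)$, $\xi(0)=\hat\xi(0)=x_0$, with zero-order hold $\hat\xi(t)=\xi(t_i)$ for $t\in[t_i,t_{i+1})$, $t_0=0$. For $k\in\mathbb{N}$ put $M(k)=e^{Ahk}+\int_0^{hk}e^{A\tau}\,d\tau\,BK_{\mathrm{c}}$ and $N(k)=\begin{bmatrix}M(k)\\ I\end{bmatrix}^{\mathsf T}Q\begin{bmatrix}M(k)\\ I\end{bmatrix}$. The discrete inter-event time is $\kappa(x)=\min\{k\in\{1,\dots,\bar k\}: x^{\mathsf T}N(k)x>0\text{ or }k=\bar k\}$. The PETC (periodic event-triggered control) system is the plant with $t_{i+1}=t_i+h\kappa(\xi(t_i))$.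 A system is GES if there are $M<\infty$, $b>0$ such that every solution satisfies $|\xi(t)|\le Me^{-bt}|\xi(0)|$ for every initial state $\xi(0)$; such a $b$ is called a decay rate estimate of the system. $\log$ is the natural logarithm. $V(x)=x^{\mathsf T}Px$ with $P$ symmetric positive definite. $\underline{k}:=\min\{k\in\{1,\dots,\bar k\}: N(k)\text{ is not negative semidefinite}\}$; $K:=\{\underline k,\dots,\bar k\}$. $r<1$ is a given contraction ratio and $N:=\lceil\log_a(r)\rceil$. $K^m$ is the set of sequences of length $m$ with entries in $K$, and $\mathbb{K}_N:=\bigcup_{i=1}^NK^i\cup\{\varepsilon\}$, $\varepsilon$ the empty sequence. Put $V_0=1$, $\mathcal{X}=\mathcal{X}_0=\{x\in\mathbb{R}^{n_x}:V(x)\le V_0\}$, $\mathcal{X}_{\mathrm{P}}=\{x\in\mathbb{R}^{n_x}:V(x)\le rV_0\}$. Let $\mathcal{K}_k=\{x\in\mathcal{X}:x^{\mathsf T}N(k)x>0\}$ for $k<\bar k$, $\mathcal{K}_{\bar k}=\mathcal{X}$, and $\mathcal{Q}_k=\mathcal{K}_k\cap\bigcap_{j=\underline k}^{k-1}\bar{\mathcal{K}}_j$, where the bar denotes complement. The relation $\mathcal{R}_{\mathrm{S'}}\subseteq\mathbb{R}^{n_x}\times\mathbb{K}_N$ is given by: $(x,k_1k_2\cdots k_m)\in\mathcal{R}_{\mathrm{S'}}$ iff $z:=x/\sqrt{V(x)}$ satisfies $z\in\mathcal{X}_0$, $z\in\mathcal{Q}_{k_1}$, $M(k_{i-1})\cdots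 M(k_1)z\in\mathcal{Q}_{k_i}$ for $i=2,\dots,m$, $z\notin\mathcal{X}_{\mathrm{P}}$, $M(k_i)\cdots M(k_1)z\notin\mathcal{X}_{\mathrm{P}}$ for $i=1,\dots,m-1$, and $M(k_m)\cdots M(k_1)z\in\mathcal{X}_{\mathrm{P}}$. $\mathcal{X}^{\mathrm{S'}}:=\{\sigma\in\mathbb{K}_N:(x,\sigma)\in\mathcal{R}_{\mathrm{S'}}\text{ for some }x\in\mathbb{R}^{n_x}\}$.
   Formalization: "Upper bound for the GES decay rate" is false if read as b ≤ b* for every decay rate estimate b; proved instead: b* is itself a decay rate estimate. Also r > 0 is assumed, N = 1 if a = 0, and the minimum defining k-underbar is k-bar when no such k exists. *)

theory Defs
  imports "HOL-Analysis.Analysis"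
begin

text \<open>
  The matrix exponential is given by its power series, since \<open>real ^ 'n ^ 'n\<close> is not an
  instance of \<open>real_normed_algebra_1\<close> and \<open>exp\<close> is unavailable for it.
\<close>

primrec matpow :: "real ^ 'n ^ 'n \<Rightarrow> nat \<Rightarrow> real ^ 'n ^ 'n" where
  "matpow A 0 = mat 1"
| "matpow A (Suc n) = A ** matpow A n"

definition mexp :: "real ^ 'n ^ 'n \<Rightarrow> real ^ 'n ^ 'n" where
  "mexp A = (\<Sum>n. matpow A n /\<^sub>R fact n)"

definition qform :: "real ^ 'n ^ 'n \<Rightarrow> real ^ 'n \<Rightarrow> real" where
  "qform S x = x \<bullet> (S *v x)"

definition symmetric_matrix :: "real ^ 'n ^ 'n \<Rightarrow> bool" where
  "symmetric_matrix S \<longleftrightarrow> transpose S = S"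

definition pos_definite :: "real ^ 'n ^ 'n \<Rightarrow> bool" where
  "pos_definite S \<longleftrightarrow> (\<forall>x. x \<noteq> 0 \<longrightarrow> qform S x > 0)"

definition neg_semidefinite :: "real ^ 'n ^ 'n \<Rightarrow> bool" where
  "neg_semidefinite S \<longleftrightarrow> (\<forall>x. qform S x \<le> 0)"

definition stack :: "real ^ 'n ^ 'p \<Rightarrow> real ^ 'n ^ 'q \<Rightarrow> real ^ 'n ^ ('p + 'q)" where
  "stack X Y = (\<chi> i. case i of Inl p \<Rightarrow> X $ p | Inr q \<Rightarrow> Y $ q)"

definition Mmat ::
  "real ^ 'x ^ 'x \<Rightarrow> real ^ 'u ^ 'x \<Rightarrow> real ^ 'x ^ 'u \<Rightarrow> real \<Rightarrow> nat \<Rightarrow> real ^ 'x ^ 'x" where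
  "Mmat A B Kc h k =
     mexp ((h * real k) *\<^sub>R A) +
     integral {0..h * real k} (\<lambda>\<tau>. mexp (\<tau> *\<^sub>R A)) ** B ** Kc"

definition Nmat ::
  "real ^ 'x ^ 'x \<Rightarrow> real ^ 'u ^ 'x \<Rightarrow> real ^ 'x ^ 'u \<Rightarrow> real ^ ('x + 'x) ^ ('x + 'x) \<Rightarrow>
   real \<Rightarrow> nat \<Rightarrow> real ^ 'x ^ 'x" where
  "Nmat A B Kc Q h k =
     transpose (stack (Mmat A B Kc h k) (mat 1)) ** Q ** stack (Mmat A B Kc h k) (mat 1)"

definition inter_event ::
  "real ^ 'x ^ 'x \<Rightarrow> real ^ 'u ^ 'x \<Rightarrow> real ^ 'x ^ 'u \<Rightarrow> real ^ ('x + 'x) ^ ('x + 'x) \<Rightarrow>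
   real \<Rightarrow> nat \<Rightarrow> real ^ 'x \<Rightarrow> nat" where
  "inter_event A B Kc Q h kbar x =
     Min {k \<in> {1..kbar}. qform (Nmat A B Kc Q h k) x > 0 \<or> k = kbar}"

text \<open>
  A solution consists of the sampling instants, the state and the held state. Since the held
  state jumps at the sampling instants, the differential equation holds at \<open>t i\<close> with
  the right derivative; continuity of the state glues the pieces together.
\<close>

definition petc_solution ::
  "real ^ 'x ^ 'x \<Rightarrow> real ^ 'u ^ 'x \<Rightarrow> real ^ 'x ^ 'u \<Rightarrow> real ^ ('x + 'x) ^ ('x + 'x) \<Rightarrow>
   real \<Rightarrow> nat \<Rightarrow> (nat \<Rightarrow> real) \<Rightarrow> (real \<Rightarrow> real ^ 'x) \<Rightarrow> (real \<Rightarrow> real ^ 'x) \<Rightarrow> bool" where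
  "petc_solution A B Kc Q h kbar t \<xi> \<xi>h \<longleftrightarrow>
     t 0 = 0 \<and>
     (\<forall>i. t (Suc i) = t i + h * real (inter_event A B Kc Q h kbar (\<xi> (t i)))) \<and>
     continuous_on {0..} \<xi> \<and>
     (\<forall>i. \<forall>s \<in> {t i..<t (Suc i)}.
        \<xi>h s = \<xi> (t i) \<and>
        (\<xi> has_vector_derivative (A *v \<xi> s + (B ** Kc) *v \<xi>h s))
          (at s within {t i..<t (Suc i)}))"

definition decay_rate_estimate ::
  "real ^ 'x ^ 'x \<Rightarrow> real ^ 'u ^ 'x \<Rightarrow> real ^ 'x ^ 'u \<Rightarrow> real ^ ('x + 'x) ^ ('x + 'x) \<Rightarrow>
   real \<Rightarrow> nat \<Rightarrow> real \<Rightarrow> bool" where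
  "decay_rate_estimate A B Kc Q h kbar b \<longleftrightarrow>
     b > 0 \<and>
     (\<exists>C. \<forall>t \<xi> \<xi>h. petc_solution A B Kc Q h kbar t \<xi> \<xi>h \<longrightarrow>
        (\<forall>s\<ge>0. norm (\<xi> s) \<le> C * exp (- b * s) * norm (\<xi> 0)))"

definition GES ::
  "real ^ 'x ^ 'x \<Rightarrow> real ^ 'u ^ 'x \<Rightarrow> real ^ 'x ^ 'u \<Rightarrow> real ^ ('x + 'x) ^ ('x + 'x) \<Rightarrow>
   real \<Rightarrow> nat \<Rightarrow> bool" where
  "GES A B Kc Q h kbar \<longleftrightarrow> (\<exists>b. decay_rate_estimate A B Kc Q h kbar b)"

text \<open>
  Including \<open>kbar\<close> in the minimum only matters if no \<open>N(k)\<close> with \<open>k\<close> in \<open>{1..kbar}\<close> fails to be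
  negative semidefinite; then every inter-event time equals \<open>kbar\<close>.
\<close>

definition kmin ::
  "real ^ 'x ^ 'x \<Rightarrow> real ^ 'u ^ 'x \<Rightarrow> real ^ 'x ^ 'u \<Rightarrow> real ^ ('x + 'x) ^ ('x + 'x) \<Rightarrow>
   real \<Rightarrow> nat \<Rightarrow> nat" where
  "kmin A B Kc Q h kbar =
     Min {k \<in> {1..kbar}. \<not> neg_semidefinite (Nmat A B Kc Q h k) \<or> k = kbar}"

text \<open>
  For \<open>a = 0\<close> the logarithm to base \<open>a\<close> is undefined; the value 1 is the limit of
  \<open>\<lceil>log a r\<rceil>\<close> as \<open>a\<close> tends to 0 from the right, for \<open>0 < r < 1\<close>.
\<close>

definition Nlen :: "real \<Rightarrow> real \<Rightarrow> nat" where
  "Nlen a r = (if a = 0 then 1 else nat \<lceil>log a r\<rceil>)"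

definition seqs :: "nat set \<Rightarrow> nat \<Rightarrow> nat list set" where
  "seqs K N = (\<Union>i\<in>{1..N}. {\<sigma>. set \<sigma> \<subseteq> K \<and> length \<sigma> = i}) \<union> {[]}"

definition sublevel :: "real ^ 'x ^ 'x \<Rightarrow> real \<Rightarrow> (real ^ 'x) set" where
  "sublevel P c = {x. qform P x \<le> c}"

definition Kset ::
  "real ^ 'x ^ 'x \<Rightarrow> real ^ 'u ^ 'x \<Rightarrow> real ^ 'x ^ 'u \<Rightarrow> real ^ ('x + 'x) ^ ('x + 'x) \<Rightarrow>
   real \<Rightarrow> nat \<Rightarrow> real ^ 'x ^ 'x \<Rightarrow> nat \<Rightarrow> (real ^ 'x) set" where
  "Kset A B Kc Q h kbar P k =
     (if k < kbar then {x \<in> sublevel P 1. qform (Nmat A B Kc Q h k) x > 0} else sublevel P 1)"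

definition Qset ::
  "real ^ 'x ^ 'x \<Rightarrow> real ^ 'u ^ 'x \<Rightarrow> real ^ 'x ^ 'u \<Rightarrow> real ^ ('x + 'x) ^ ('x + 'x) \<Rightarrow>
   real \<Rightarrow> nat \<Rightarrow> real ^ 'x ^ 'x \<Rightarrow> nat \<Rightarrow> (real ^ 'x) set" where
  "Qset A B Kc Q h kbar P k =
     Kset A B Kc Q h kbar P k \<inter>
     (\<Inter>j\<in>{kmin A B Kc Q h kbar..<k}. - Kset A B Kc Q h kbar P j)"

text \<open>\<open>run A B Kc h z [k1, ..., km]\<close> is \<open>M(km) ... M(k1) z\<close>.\<close>

definition run ::
  "real ^ 'x ^ 'x \<Rightarrow> real ^ 'u ^ 'x \<Rightarrow> real ^ 'x ^ 'u \<Rightarrow> real \<Rightarrow>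
   real ^ 'x \<Rightarrow> nat list \<Rightarrow> real ^ 'x" where
  "run A B Kc h z \<sigma> = foldl (\<lambda>y k. Mmat A B Kc h k *v y) z \<sigma>"

text \<open>
  Indices are shifted to start at 0, so that \<open>i = 0\<close> below is the condition on \<open>z\<close> itself.
  For \<open>x = 0\<close> the normalised state is \<open>z = 0\<close>, which is in \<open>sublevel P r\<close>: the origin is
  related to no sequence. Likewise the empty sequence is related to no state.
\<close>

definition R_S' ::
  "real ^ 'x ^ 'x \<Rightarrow> real ^ 'u ^ 'x \<Rightarrow> real ^ 'x ^ 'u \<Rightarrow> real ^ ('x + 'x) ^ ('x + 'x) \<Rightarrow>
   real \<Rightarrow> nat \<Rightarrow> real ^ 'x ^ 'x \<Rightarrow> real \<Rightarrow> real \<Rightarrow> ((real ^ 'x) \<times> nat list) set" where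
  "R_S' A B Kc Q h kbar P a r =
     {(x, \<sigma>). \<sigma> \<in> seqs {kmin A B Kc Q h kbar..kbar} (Nlen a r) \<and>
        (let z = x /\<^sub>R sqrt (qform P x) in
           z \<in> sublevel P 1 \<and>
           (\<forall>i<length \<sigma>. run A B Kc h z (take i \<sigma>) \<in> Qset A B Kc Q h kbar P (\<sigma> ! i)) \<and>
           z \<notin> sublevel P r \<and>
           (\<forall>i<length \<sigma>. run A B Kc h z (take i \<sigma>) \<notin> sublevel P r) \<and>
           run A B Kc h z \<sigma> \<in> sublevel P r)}"

definition X_S' ::
  "real ^ 'x ^ 'x \<Rightarrow> real ^ 'u ^ 'x \<Rightarrow> real ^ 'x ^ 'u \<Rightarrow> real ^ ('x + 'x) ^ ('x + 'x) \<Rightarrow>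
   real \<Rightarrow> nat \<Rightarrow> real ^ 'x ^ 'x \<Rightarrow> real \<Rightarrow> real \<Rightarrow> nat list set" where
  "X_S' A B Kc Q h kbar P a r =
     {\<sigma> \<in> seqs {kmin A B Kc Q h kbar..kbar} (Nlen a r).
        \<exists>x. (x, \<sigma>) \<in> R_S' A B Kc Q h kbar P a r}"

definition T_star ::
  "real ^ 'x ^ 'x \<Rightarrow> real ^ 'u ^ 'x \<Rightarrow> real ^ 'x ^ 'u \<Rightarrow> real ^ ('x + 'x) ^ ('x + 'x) \<Rightarrow>
   real \<Rightarrow> nat \<Rightarrow> real ^ 'x ^ 'x \<Rightarrow> real \<Rightarrow> real \<Rightarrow> real" where
  "T_star A B Kc Q h kbar P a r =
     h * real (Max (sum_list ` X_S' A B Kc Q h kbar P a r))"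

end

theory Submission
  imports Defs
begin

text \<open>
  Scaling leaves \<open>\<kappa>\<close> invariant, so \<open>x \<mapsto> M(\<kappa>(x)) x\<close> commutes with it and a run from any \<open>x \<noteq> 0\<close> can
  be normalised to \<open>V = 1\<close>. Since \<open>V\<close> contracts by \<open>a\<close> at each event and \<open>a ^ N \<le> r\<close>, the normalised run
  first enters \<open>V \<le> r\<close> after at most \<open>N\<close> events, and its event sequence up to then is one of those
  over which \<open>T\<^sup>*\<close> maximises. Hence from each sampling instant, \<open>V\<close> drops by the factor \<open>r\<close> at some
  event within time \<open>T\<^sup>*\<close>; iterating gives the rate \<open>- ln r / (2 T\<^sup>*)\<close> at a subsequence of the
  events, and the assumed GES bound, applied from these events on, covers the times in between.
  Solutions exist from every initial state by variation of constants; this transfers the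
  contraction to all states and also shows that \<open>T\<^sup>*\<close> is a maximum over a nonempty set.
\<close>

section \<open>The matrix exponential and the flow between events\<close>

lemma bounded_bilinear_matrix_vector_mult:
  "bounded_bilinear ((*v) :: real ^ 'n ^ 'm \<Rightarrow> real ^ 'n \<Rightarrow> real ^ 'm)"
proof -
  have "bilinear ((*v) :: real ^ 'n ^ 'm \<Rightarrow> real ^ 'n \<Rightarrow> real ^ 'm)"
    unfolding bilinear_def
    by (auto intro!: linearI simp: matrix_vector_mult_add_rdistrib matrix_vector_right_distrib
        scaleR_matrix_vector_assoc matrix_vector_mult_scaleR)
  then show ?thesis by (simp add: bilinear_conv_bounded_bilinear)
qed

lemmas bounded_linear_matrix_vector_mult_left =
  bounded_bilinear.bounded_linear_left[OF bounded_bilinear_matrix_vector_mult]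

text \<open>The basis vectors are the \<open>axis i c\<close>, and the inner product with one reads
  component \<open>i\<close> against \<open>c\<close>. The component type stays general so that the
  rule can be used twice, for the rows and then the entries of a matrix.\<close>

lemma has_vector_derivative_vec:
  fixes f :: "real \<Rightarrow> 'a::euclidean_space ^ 'n"
  assumes "\<And>i. ((\<lambda>t. f t $ i) has_vector_derivative f' $ i) (at x within S)"
  shows "(f has_vector_derivative f') (at x within S)"
  unfolding has_vector_derivative_def has_derivative_componentwise_within[of f]
proof
  fix b :: "'a ^ 'n" assume "b \<in> Basis"
  then obtain i c where b: "b = axis i c" by (auto simp: Basis_vec_def)
  show "((\<lambda>t. f t \<bullet> b) has_derivative (\<lambda>t. (t *\<^sub>R f') \<bullet> b)) (at x within S)"
    using bounded_linear.has_derivative[OF bounded_linear_inner_left[of c]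
        assms[of i, unfolded has_vector_derivative_def]]
    by (simp add: b inner_axis)
qed

section \<open>The matrix exponential as an entrywise power series\<close>

lemma matpow_scaleR: "matpow (t *\<^sub>R A) n = t ^ n *\<^sub>R matpow A n"
  by (induction n) (simp_all add: matrix_scalar_ac flip: scalar_matrix_assoc)

lemma matpow_Suc_right: "matpow A (Suc n) = matpow A n ** A"
  by (induction n) (simp_all add: matrix_mul_assoc)

text \<open>The base dominates every absolute row sum of \<open>A\<close>, so one more factor
  \<open>A\<close> enlarges a common bound on all entries at most by the base. Geometric growth
  suffices for comparison with the scalar exponential series.\<close>

lemma matpow_entry_bound:
  fixes A :: "real ^ 'n ^ 'n"
  shows "\<bar>matpow A n $ i $ j\<bar> \<le> (1 + (\<Sum>i\<in>UNIV. \<Sum>k\<in>UNIV. \<bar>A $ i $ k\<bar>)) ^ n"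
    (is "_ \<le> ?c ^ n")
proof (induction n arbitrary: i j)
  case 0
  show ?case by (simp add: mat_def)
next
  case (Suc n)
  have row: "(\<Sum>k\<in>UNIV. \<bar>A $ i $ k\<bar>) \<le> ?c"
    using member_le_sum[of i UNIV "\<lambda>i. \<Sum>k\<in>UNIV. \<bar>A $ i $ k\<bar>"]
    by (smt (verit) UNIV_I finite sum_nonneg abs_ge_zero DiffD1)
  have "\<bar>matpow A (Suc n) $ i $ j\<bar> \<le> (\<Sum>k\<in>UNIV. \<bar>A $ i $ k\<bar> * \<bar>matpow A n $ k $ j\<bar>)"
    by (simp add: matrix_matrix_mult_def order.trans[OF sum_abs] abs_mult)
  also have "\<dots> \<le> (\<Sum>k\<in>UNIV. \<bar>A $ i $ k\<bar> * ?c ^ n)"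
    by (intro sum_mono mult_left_mono Suc.IH) auto
  also have "\<dots> = (\<Sum>k\<in>UNIV. \<bar>A $ i $ k\<bar>) * ?c ^ n"
    by (simp add: sum_distrib_right)
  also have "\<dots> \<le> ?c * ?c ^ n"
    by (intro mult_right_mono row zero_le_power) (simp add: add_nonneg_nonneg sum_nonneg)
  finally show ?case by simp
qed

lemma summable_matpow_entry:
  fixes A :: "real ^ 'n ^ 'n"
  shows "summable (\<lambda>n. matpow A n $ i $ j / fact n * t ^ n)"
proof -
  let ?c = "1 + (\<Sum>i\<in>UNIV. \<Sum>k\<in>UNIV. \<bar>A $ i $ k\<bar>)"
  show ?thesis
  proof (rule summable_comparison_test'[OF summable_exp[of "?c * \<bar>t\<bar>"]])
    fix n :: nat
    show "norm (matpow A n $ i $ j / fact n * t ^ n) \<le> inverse (fact n) * (?c * \<bar>t\<bar>) ^ n"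
      using mult_right_mono[OF matpow_entry_bound[of A n i j], of "\<bar>t\<bar> ^ n / fact n"]
      by (simp add: abs_mult power_mult_distrib power_abs divide_inverse mult_ac)
  qed
qed

lemma mexp_entry:
  "mexp (t *\<^sub>R A) $ i $ j = (\<Sum>n. matpow A n $ i $ j / fact n * t ^ n)"
proof -
  have "(\<lambda>n. matpow (t *\<^sub>R A) n /\<^sub>R fact n) sums
      (\<chi> i j. \<Sum>n. matpow A n $ i $ j / fact n * t ^ n)"
    unfolding sums_def
    by (rule vec_tendstoI)+
      (use summable_sums[OF summable_matpow_entry] in
        \<open>simp add: sums_def matpow_scaleR field_simps\<close>)
  then show ?thesis
    unfolding mexp_def by (simp add: sums_unique[symmetric])
qed

lemma mexp_0 [simp]: "mexp (0 :: real ^ 'n ^ 'n) = mat 1"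
  using mexp_entry[of 0 "0 :: real ^ 'n ^ 'n"]
  by (simp add: vec_eq_iff powser_zero del: times_divide_eq_left)

section \<open>Derivative of the matrix exponential\<close>

lemma mexp_entry_deriv:
  "((\<lambda>t. mexp (t *\<^sub>R A) $ i $ j) has_vector_derivative
     (\<Sum>n. matpow A (Suc n) $ i $ j / fact n * t ^ n)) (at t)"
proof -
  \<comment> \<open>\<open>diffs\<close> multiplies the coefficient of index \<open>n + 1\<close> by
    \<open>n + 1\<close>, which turns \<open>fact (Suc n)\<close> into
    \<open>fact n\<close>.\<close>
  have eq: "diffs (\<lambda>n. matpow A n $ i $ j / fact n) = (\<lambda>n. matpow A (Suc n) $ i $ j / fact n)"
    by (rule ext) (simp add: diffs_def del: matpow.simps of_nat_Suc)
  show ?thesis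
    using termdiffs_strong_converges_everywhere[OF summable_matpow_entry[of A i j], of t]
    by (simp add: mexp_entry eq has_real_derivative_iff_has_vector_derivative del: matpow.simps)
qed

lemma mexp_deriv_entry_left:
  "(\<Sum>n. matpow A (Suc n) $ i $ j / fact n * t ^ n) = (A ** mexp (t *\<^sub>R A)) $ i $ j"
proof -
  have "(\<lambda>n. \<Sum>k\<in>UNIV. A $ i $ k * (matpow A n $ k $ j / fact n * t ^ n)) sums
      (\<Sum>k\<in>UNIV. A $ i $ k * mexp (t *\<^sub>R A) $ k $ j)"
    unfolding mexp_entry by (intro sums_sum sums_mult summable_sums summable_matpow_entry)
  then show ?thesis
    by (simp add: matrix_matrix_mult_def sum_divide_distrib sum_distrib_right mult.assoc
        sums_unique[symmetric])
qed

text \<open>The extra factor of the power is split off on the right here. Together with the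
  left-hand version, one series gets two factorisations, which is the whole reason for
  \<open>mexp_commute\<close>.\<close>

lemma mexp_deriv_entry_right:
  "(\<Sum>n. matpow A (Suc n) $ i $ j / fact n * t ^ n) = (mexp (t *\<^sub>R A) ** A) $ i $ j"
proof -
  have "(\<lambda>n. \<Sum>k\<in>UNIV. (matpow A n $ i $ k / fact n * t ^ n) * A $ k $ j) sums
      (\<Sum>k\<in>UNIV. mexp (t *\<^sub>R A) $ i $ k * A $ k $ j)"
    unfolding mexp_entry by (intro sums_sum sums_mult2 summable_sums summable_matpow_entry)
  moreover have "(\<Sum>k\<in>UNIV. (matpow A n $ i $ k / fact n * t ^ n) * A $ k $ j) =
      matpow A (Suc n) $ i $ j / fact n * t ^ n" for n
    unfolding matpow_Suc_right
    by (simp add: matrix_matrix_mult_def sum_divide_distrib sum_distrib_right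
        sum_distrib_left mult_ac)
  ultimately show ?thesis
    by (simp add: matrix_matrix_mult_def sums_unique[symmetric] del: matpow.simps)
qed

lemma mexp_deriv:
  "((\<lambda>t. mexp (t *\<^sub>R A)) has_vector_derivative A ** mexp (t *\<^sub>R A)) (at t within S)"
  by (intro has_vector_derivative_vec has_vector_derivative_at_within[of _ _ t S]
      mexp_entry_deriv[unfolded mexp_deriv_entry_left])

lemma mexp_commute: "mexp (t *\<^sub>R A) ** A = A ** mexp (t *\<^sub>R A)"
  by (simp add: vec_eq_iff flip: mexp_deriv_entry_left mexp_deriv_entry_right)

lemma continuous_on_mexp: "continuous_on S (\<lambda>t. mexp (t *\<^sub>R A))"
  by (rule continuous_on_vector_derivative[OF mexp_deriv])

lemma has_vector_derivative_mexp_vec: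
  "((\<lambda>t. mexp (t *\<^sub>R A) *v y) has_vector_derivative A *v (mexp (t *\<^sub>R A) *v y)) (at t within S)"
  using bounded_linear.has_vector_derivative[OF bounded_linear_matrix_vector_mult_left mexp_deriv]
  by (simp add: matrix_vector_mul_assoc)

text \<open>State after a time \<open>T\<close> without sampling, where \<open>x\<close> is both the initial and the held state.\<close>

definition flow ::
  "real ^ 'x ^ 'x \<Rightarrow> real ^ 'u ^ 'x \<Rightarrow> real ^ 'x ^ 'u \<Rightarrow> real \<Rightarrow> real ^ 'x \<Rightarrow> real ^ 'x" where
  "flow A B Kc T x =
     mexp (T *\<^sub>R A) *v x + integral {0..T} (\<lambda>\<tau>. mexp (\<tau> *\<^sub>R A) *v ((B ** Kc) *v x))"

lemma Mmat_eq_flow: "Mmat A B Kc h k *v x = flow A B Kc (h * real k) x"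
proof -
  have "(\<lambda>\<tau>. mexp (\<tau> *\<^sub>R A)) integrable_on {0..h * real k}"
    by (intro integrable_continuous_real continuous_on_mexp)
  from integral_linear[OF this bounded_linear_matrix_vector_mult_left, of "(B ** Kc) *v x"]
  show ?thesis
    by (simp add: Mmat_def flow_def matrix_vector_mult_add_rdistrib o_def
        matrix_vector_mul_assoc matrix_mul_assoc)
qed

lemma flow_0 [simp]: "flow A B Kc 0 x = x"
  by (simp add: flow_def)

lemma flow_deriv:
  assumes "0 \<le> s"
  shows "((\<lambda>s. flow A B Kc s x) has_vector_derivative A *v flow A B Kc s x + (B ** Kc) *v x)
           (at s within {0..})"
proof -
  let ?y = "(B ** Kc) *v x"
  let ?g = "\<lambda>\<tau>. mexp (\<tau> *\<^sub>R A) *v ?y"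
  have cont: "continuous_on S ?g" for S
    by (rule continuous_on_vector_derivative[OF has_vector_derivative_mexp_vec])
  have "((\<lambda>u. integral {0..u} ?g) has_vector_derivative ?g s) (at s within {0..s + 1})"
    using assms by (intro integral_has_vector_derivative cont) auto
  moreover have "at s within {0..s + 1} = at s within {0..}"
    using assms by (intro at_within_nhd[of s "{..<s + 1}"]) auto
  ultimately have "((\<lambda>u. integral {0..u} ?g) has_vector_derivative ?g s) (at s within {0..})"
    by simp
  from has_vector_derivative_add[OF has_vector_derivative_mexp_vec this]
  have "((\<lambda>s. flow A B Kc s x) has_vector_derivative
      A *v (mexp (s *\<^sub>R A) *v x) + ?g s) (at s within {0..})"
    unfolding flow_def .
  \<comment> \<open>The fundamental theorem for \<open>?g\<close>, whose derivative is
    \<open>A *v ?g\<close>, rewrites this term; the value \<open>?g 0\<close> is the constant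
    input.\<close>
  moreover have "?g s = A *v integral {0..s} ?g + ?y"
  proof -
    have "((\<lambda>\<tau>. A *v ?g \<tau>) has_integral ?g s - ?g 0) {0..s}"
      by (rule fundamental_theorem_of_calculus[OF assms has_vector_derivative_mexp_vec])
    moreover have "((\<lambda>\<tau>. A *v ?g \<tau>) has_integral A *v integral {0..s} ?g) {0..s}"
      using has_integral_linear[OF integrable_integral[OF
            integrable_continuous_real[OF cont]] matrix_vector_mul_bounded_linear[of A]]
      by (simp add: o_def)
    ultimately have "?g s - ?g 0 = A *v integral {0..s} ?g"
      by (rule has_integral_unique)
    then show ?thesis by (simp add: algebra_simps)
  qed
  ultimately show ?thesis
    by (simp add: flow_def matrix_vector_right_distrib add.assoc)
qed

text \<open>Variation of constants: differentiate \<open>s \<mapsto> mexp ((T - s) A) *v \<xi> s\<close>.\<close>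

lemma flow_unique:
  assumes "0 \<le> T" and cont: "continuous_on {0..T} \<xi>"
    and deriv: "\<And>s. 0 < s \<Longrightarrow> s < T \<Longrightarrow>
      (\<xi> has_vector_derivative A *v \<xi> s + (B ** Kc) *v \<xi> 0) (at s)"
  shows "\<xi> T = flow A B Kc T (\<xi> 0)"
proof -
  let ?y = "(B ** Kc) *v \<xi> 0"
  have E: "((\<lambda>s. mexp ((T - s) *\<^sub>R A)) has_vector_derivative - (A ** mexp ((T - s) *\<^sub>R A)))
      (at s within S)" for s S
  proof -
    have "((\<lambda>s. T - s) has_vector_derivative - 1) (at s within S)"
      by (auto intro!: derivative_eq_intros)
    from vector_diff_chain_within[OF this mexp_deriv] show ?thesis
      by (simp add: o_def)
  qed
  have "((\<lambda>s. mexp ((T - s) *\<^sub>R A) *v ?y) has_integral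
      mexp ((T - T) *\<^sub>R A) *v \<xi> T - mexp ((T - 0) *\<^sub>R A) *v \<xi> 0) {0..T}"
  proof (rule fundamental_theorem_of_calculus_interior[OF assms(1)])
    show "continuous_on {0..T} (\<lambda>s. mexp ((T - s) *\<^sub>R A) *v \<xi> s)"
      by (intro bounded_bilinear.continuous_on[OF bounded_bilinear_matrix_vector_mult] cont
          continuous_on_vector_derivative[OF E])
    fix s assume s: "s \<in> {0<..<T}"
    then have "(\<xi> has_vector_derivative A *v \<xi> s + ?y) (at s)"
      by (intro deriv) auto
    \<comment> \<open>In the product rule the two terms containing \<open>A\<close> cancel, because
      \<open>mexp\<close> commutes with \<open>A\<close>.\<close>
    from bounded_bilinear.has_vector_derivative[OF bounded_bilinear_matrix_vector_mult E this]
    show "((\<lambda>s. mexp ((T - s) *\<^sub>R A) *v \<xi> s) has_vector_derivative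
        mexp ((T - s) *\<^sub>R A) *v ?y) (at s)"
      by (simp add: matrix_vector_right_distrib matrix_vector_mul_assoc mexp_commute
          bounded_bilinear.minus_left[OF bounded_bilinear_matrix_vector_mult])
  qed
  \<comment> \<open>Substitution \<open>\<tau> = T - s\<close>, composed of a reflection and a shift
    by \<open>T\<close>.\<close>
  moreover have "integral {0..T} (\<lambda>s. mexp ((T - s) *\<^sub>R A) *v ?y) =
      integral {0..T} (\<lambda>\<tau>. mexp (\<tau> *\<^sub>R A) *v ?y)"
    using Henstock_Kurzweil_Integration.integral_reflect_real[of 0 "-T"
        "\<lambda>\<tau>. mexp ((T + \<tau>) *\<^sub>R A) *v ?y"]
      integral_shift_real_ivl[of 0 T T "\<lambda>\<tau>. mexp (\<tau> *\<^sub>R A) *v ?y"]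
    by (simp add: add.commute)
  ultimately show ?thesis
    by (simp add: flow_def has_integral_iff)
qed

section \<open>Solutions of the PETC system\<close>

lemma qform_scaleR: "qform S (c *\<^sub>R x) = c\<^sup>2 * qform S x"
  by (simp add: qform_def matrix_vector_mult_scaleR power2_eq_square)

locale petc =
  fixes A :: "real ^ 'x ^ 'x" and B :: "real ^ 'u ^ 'x" and Kc :: "real ^ 'x ^ 'u"
    and Q :: "real ^ ('x + 'x) ^ ('x + 'x)" and h :: real and kbar :: nat
  assumes h_pos: "h > 0" and kbar_ge_1: "kbar \<ge> 1"
begin

abbreviation kappa :: "real ^ 'x \<Rightarrow> nat" where
  "kappa \<equiv> inter_event A B Kc Q h kbar"

abbreviation solution ::
  "(nat \<Rightarrow> real) \<Rightarrow> (real \<Rightarrow> real ^ 'x) \<Rightarrow> (real \<Rightarrow> real ^ 'x) \<Rightarrow> bool" where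
  "solution \<equiv> petc_solution A B Kc Q h kbar"

definition step :: "real ^ 'x \<Rightarrow> real ^ 'x" where
  "step x = Mmat A B Kc h (kappa x) *v x"

definition events :: "nat \<Rightarrow> real ^ 'x \<Rightarrow> nat list" where
  "events n x = map (\<lambda>i. kappa ((step ^^ i) x)) [0..<n]"

section \<open>Inter-event times and event sequences of the sampled recursion\<close>

lemma kappa_mem: "kappa x \<in> {k \<in> {1..kbar}. qform (Nmat A B Kc Q h k) x > 0 \<or> k = kbar}"
  unfolding inter_event_def using kbar_ge_1 by (intro Min_in) auto

lemma kappa_bounds: "1 \<le> kappa x" "kappa x \<le> kbar"
  using kappa_mem[of x] by auto

lemma qform_Nmat_before_event:
  assumes "1 \<le> j" "j < kappa x"
  shows "qform (Nmat A B Kc Q h j) x \<le> 0"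
proof (rule ccontr)
  assume "\<not> ?thesis"
  then have "kappa x \<le> j"
    unfolding inter_event_def using assms kappa_bounds[of x] by (intro Min_le) auto
  with assms show False by simp
qed

text \<open>Every form is multiplied by \<open>c\<^sup>2 > 0\<close>, so the trigger condition keeps
  its truth value at each \<open>k\<close>.\<close>

lemma kappa_scaleR: "c \<noteq> 0 \<Longrightarrow> kappa (c *\<^sub>R x) = kappa x"
  by (simp add: inter_event_def qform_scaleR zero_less_mult_iff)

lemma kmin_ge_1: "1 \<le> kmin A B Kc Q h kbar"
proof -
  have "kmin A B Kc Q h kbar \<in>
      {k \<in> {1..kbar}. \<not> neg_semidefinite (Nmat A B Kc Q h k) \<or> k = kbar}"
    unfolding kmin_def using kbar_ge_1 by (intro Min_in) auto
  then show ?thesis by simp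
qed

text \<open>If the trigger fires at \<open>kappa x\<close>, then \<open>x\<close> itself witnesses
  that the form there is not negative semidefinite; otherwise \<open>kappa x = kbar\<close>. Either
  way \<open>kappa x\<close> is a candidate in the minimum.\<close>

lemma kmin_le_kappa: "kmin A B Kc Q h kbar \<le> kappa x"
  unfolding kmin_def using kappa_mem[of x]
  by (intro Min_le) (auto simp: neg_semidefinite_def not_le)

lemma step_eq_flow: "step x = flow A B Kc (h * real (kappa x)) x"
  by (simp add: step_def Mmat_eq_flow)

lemma events_Suc: "events (Suc n) x = events n x @ [kappa ((step ^^ n) x)]"
  by (simp add: events_def)

lemma take_events: "i \<le> n \<Longrightarrow> take i (events n x) = events i x"
  by (simp add: events_def take_map)

lemma length_events [simp]: "length (events n x) = n"
  by (simp add: events_def)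

lemma events_add: "events (n + m) x = events n x @ events m ((step ^^ n) x)"
proof (induction m)
  case (Suc m)
  have "(step ^^ (n + m)) x = (step ^^ m) ((step ^^ n) x)"
    by (simp add: funpow_add add.commute[of n m])
  then show ?case using Suc by (simp add: events_Suc)
qed (simp add: events_def)

text \<open>The event list is that of the unscaled \<open>x\<close>, and linearity lets
  \<open>c\<close> factor out. This links the normalised runs in \<open>R_S'\<close> to the iterates
  of \<open>step\<close>.\<close>

lemma run_events: "run A B Kc h (c *\<^sub>R x) (events n x) = c *\<^sub>R (step ^^ n) x"
proof (induction n)
  case 0
  show ?case by (simp add: run_def events_def)
next
  case (Suc n)
  have "step ((step ^^ n) x) = Mmat A B Kc h (kappa ((step ^^ n) x)) *v (step ^^ n) x"
    by (rule step_def)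
  with Suc show ?case
    by (simp add: run_def events_Suc matrix_vector_mult_scaleR)
qed

lemma sum_list_events_ge: "n \<le> sum_list (events n x)"
proof (induction n)
  case (Suc n)
  then show ?case using kappa_bounds(1)[of "(step ^^ n) x"] by (simp add: events_Suc)
qed simp

section \<open>Solutions at the sampling instants\<close>

lemma solutionD:
  assumes "solution t \<xi> \<xi>h"
  shows "t 0 = 0"
    and "t (Suc i) = t i + h * real (kappa (\<xi> (t i)))"
    and "continuous_on {0..} \<xi>"
    and "s \<in> {t i..<t (Suc i)} \<Longrightarrow> \<xi>h s = \<xi> (t i)"
    and "s \<in> {t i..<t (Suc i)} \<Longrightarrow> (\<xi> has_vector_derivative (A *v \<xi> s + (B ** Kc) *v \<xi>h s))
          (at s within {t i..<t (Suc i)})"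
  using assms unfolding petc_solution_def by blast+

lemma solution_time_less: "solution t \<xi> \<xi>h \<Longrightarrow> t i < t (Suc i)"
  using h_pos kappa_bounds(1)[of "\<xi> (t i)"] by (simp add: solutionD(2))

lemma solution_time_nonneg: "solution t \<xi> \<xi>h \<Longrightarrow> 0 \<le> t i"
proof (induction i)
  case 0
  then show ?case by (simp add: solutionD(1))
next
  case (Suc i)
  then show ?case using solution_time_less[of t \<xi> \<xi>h i] by simp
qed

text \<open>After a time shift by \<open>t i\<close> this is \<open>flow_unique\<close>: the
  differential equation inside the interval suffices, and continuity covers the right
  endpoint.\<close>

lemma solution_step:
  assumes sol: "solution t \<xi> \<xi>h"
  shows "\<xi> (t (Suc i)) = step (\<xi> (t i))"
proof -
  let ?T = "h * real (kappa (\<xi> (t i)))"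
  have T: "t (Suc i) = t i + ?T" by (rule solutionD(2)[OF sol])
  have T_pos: "0 < ?T" using solution_time_less[OF sol, of i] T by simp
  have "\<xi> (t i + ?T) = flow A B Kc ?T (\<xi> (t i + 0))"
  proof (rule flow_unique)
    show "continuous_on {0..?T} (\<lambda>s. \<xi> (t i + s))"
      using solution_time_nonneg[OF sol, of i]
      by (intro continuous_on_compose2[OF solutionD(3)[OF sol]])
        (auto intro!: continuous_intros)
    fix s assume s: "0 < s" "s < ?T"
    let ?I = "{t i<..<t (Suc i)}"
    have mem: "t i + s \<in> ?I" using s T by auto
    then have h: "\<xi>h (t i + s) = \<xi> (t i)"
      and d: "(\<xi> has_vector_derivative (A *v \<xi> (t i + s) + (B ** Kc) *v \<xi>h (t i + s)))
          (at (t i + s) within {t i..<t (Suc i)})"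
      using solutionD(4,5)[OF sol, of "t i + s" i] by auto
    from d have "(\<xi> has_vector_derivative (A *v \<xi> (t i + s) + (B ** Kc) *v \<xi> (t i)))
        (at (t i + s) within ?I)"
      unfolding h by (rule has_vector_derivative_within_subset) auto
    then have "(\<xi> has_vector_derivative (A *v \<xi> (t i + s) + (B ** Kc) *v \<xi> (t i)))
        (at (t i + s))"
      unfolding at_within_open[OF mem open_greaterThanLessThan] .
    moreover have "((\<lambda>s. t i + s) has_vector_derivative 1) (at s)"
      by (auto intro!: derivative_eq_intros)
    ultimately show "((\<lambda>s. \<xi> (t i + s)) has_vector_derivative
        A *v \<xi> (t i + s) + (B ** Kc) *v \<xi> (t i + 0)) (at s)"
      using vector_diff_chain_at[of "\<lambda>s. t i + s" 1 s \<xi>] by (simp add: o_def)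
  qed (use T_pos in simp)
  then show ?thesis by (simp add: T step_eq_flow)
qed

lemma solution_state:
  assumes sol: "solution t \<xi> \<xi>h"
  shows "\<xi> (t i) = (step ^^ i) (\<xi> 0)"
proof (induction i)
  case 0
  show ?case by (simp add: solutionD(1)[OF sol])
qed (simp add: solution_step[OF sol])

lemma solution_time:
  assumes sol: "solution t \<xi> \<xi>h"
  shows "t i = h * real (sum_list (events i (\<xi> 0)))"
proof (induction i)
  case 0
  show ?case by (simp add: solutionD(1)[OF sol] events_def)
next
  case (Suc i)
  have "t (Suc i) = t i + h * real (kappa ((step ^^ i) (\<xi> 0)))"
    using solutionD(2)[OF sol, of i] unfolding solution_state[OF sol] .
  with Suc show ?case by (simp add: events_Suc algebra_simps)
qed

text \<open>At an event the held state equals the state, so a restart there loses no memory. A bound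
  in terms of the initial state thereby applies from any later event on.\<close>

lemma solution_shift:
  assumes sol: "solution t \<xi> \<xi>h"
  shows "solution (\<lambda>j. t (i + j) - t i) (\<lambda>s. \<xi> (t i + s)) (\<lambda>s. \<xi>h (t i + s))"
  unfolding petc_solution_def
proof (intro conjI allI ballI)
  show "continuous_on {0..} (\<lambda>s. \<xi> (t i + s))"
    using solution_time_nonneg[OF sol, of i]
    by (intro continuous_on_compose2[OF solutionD(3)[OF sol]])
      (auto intro!: continuous_intros)
next
  fix j s assume s: "s \<in> {t (i + j) - t i..<t (i + Suc j) - t i}"
  let ?I = "{t (i + j)..<t (Suc (i + j))}"
  have mem: "t i + s \<in> ?I" using s by auto
  then show "\<xi>h (t i + s) = \<xi> (t i + (t (i + j) - t i))"
    using solutionD(4)[OF sol] by simp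
  have "(\<xi> has_vector_derivative (A *v \<xi> (t i + s) + (B ** Kc) *v \<xi>h (t i + s)))
      (at (t i + s) within ?I)"
    using mem by (rule solutionD(5)[OF sol])
  moreover have "(\<lambda>s. t i + s) ` {t (i + j) - t i..<t (i + Suc j) - t i} \<subseteq> ?I"
    by auto
  ultimately have \<xi>: "(\<xi> has_vector_derivative (A *v \<xi> (t i + s) + (B ** Kc) *v \<xi>h (t i + s)))
      (at (t i + s) within (\<lambda>s. t i + s) ` {t (i + j) - t i..<t (i + Suc j) - t i})"
    by (rule has_vector_derivative_within_subset)
  have "((\<lambda>s. t i + s) has_vector_derivative 1)
      (at s within {t (i + j) - t i..<t (i + Suc j) - t i})"
    by (auto intro!: derivative_eq_intros)
  from vector_diff_chain_within[OF this \<xi>]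
  show "((\<lambda>s. \<xi> (t i + s)) has_vector_derivative
      A *v \<xi> (t i + s) + (B ** Kc) *v \<xi>h (t i + s))
      (at s within {t (i + j) - t i..<t (i + Suc j) - t i})"
    by (simp add: o_def)
qed (simp_all add: solutionD(2)[OF sol])

text \<open>Flows started at the iterates of \<open>step\<close> are glued along the event times.
  Gaps of at least \<open>h\<close> keep events from accumulating, and consecutive pieces agree at
  their common endpoint by \<open>step_eq_flow\<close>.\<close>

lemma solution_exists:
  obtains t \<xi> \<xi>h where "solution t \<xi> \<xi>h" "\<xi> 0 = x"
proof -
  define X where "X = (\<lambda>i. (step ^^ i) x)"
  define t where "t = (\<lambda>i. h * real (sum_list (events i x)))"
  define idx where "idx = (\<lambda>s. LEAST n. s < t (Suc n))"
  define \<xi> where "\<xi> = (\<lambda>s. flow A B Kc (s - t (idx s)) (X (idx s)))"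
  have t_0: "t 0 = 0" by (simp add: t_def events_def)
  have t_Suc: "t (Suc i) = t i + h * real (kappa (X i))" for i
    by (simp add: t_def X_def events_Suc algebra_simps)
  have t_less: "t i < t (Suc i)" for i
    using h_pos kappa_bounds(1)[of "X i"] by (simp add: t_Suc)
  then have "strict_mono t" by (simp add: strict_mono_Suc_iff)
  note t_mono = strict_mono_less[OF this] strict_mono_less_eq[OF this]
  have t_nonneg: "0 \<le> t i" for i using t_mono(2)[of 0 i] t_0 by simp
  have t_unbounded: "\<exists>n. s < t n" for s
  proof -
    obtain n :: nat where "s / h < n" using reals_Archimedean2 by blast
    then have "s < h * n" using h_pos by (simp add: field_simps)
    also have "\<dots> \<le> t n" using sum_list_events_ge[of n x] h_pos by (simp add: t_def)
    finally show ?thesis ..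
  qed
  have idx_eq: "idx s = i" if "s \<in> {t i..<t (Suc i)}" for s i
    unfolding idx_def
  proof (rule Least_equality)
    fix n assume "s < t (Suc n)"
    with that have "t i < t (Suc n)" by auto
    then show "i \<le> n" by (simp add: t_mono)
  qed (use that in auto)
  have \<xi>_t: "\<xi> (t i) = X i" for i
    using idx_eq[of "t i" i] t_less[of i] by (simp add: \<xi>_def)
  \<comment> \<open>Including the right endpoint gives the formula on closed intervals, which can be
    pasted for continuity.\<close>
  have \<xi>_eq: "\<xi> s = flow A B Kc (s - t i) (X i)" if "s \<in> {t i..t (Suc i)}" for s i
  proof (cases "s = t (Suc i)")
    case True
    then show ?thesis by (simp add: \<xi>_t) (simp add: t_Suc X_def step_eq_flow)
  next
    case False
    with that have "idx s = i" by (intro idx_eq) auto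
    then show ?thesis by (simp add: \<xi>_def)
  qed
  have flow_t: "((\<lambda>s. flow A B Kc (s - t i) (X i)) has_vector_derivative
      A *v flow A B Kc (s - t i) (X i) + (B ** Kc) *v X i) (at s within {t i..t (Suc i)})"
    if "s \<in> {t i..t (Suc i)}" for s i
  proof -
    have "((\<lambda>s. s - t i) has_vector_derivative 1) (at s within {t i..t (Suc i)})"
      by (auto intro!: derivative_eq_intros)
    from vector_diff_chain_within[OF this, of "\<lambda>s. flow A B Kc s (X i)"] that
    show ?thesis
      by (simp add: o_def has_vector_derivative_within_subset[OF flow_deriv])
  qed
  have \<xi>_deriv: "(\<xi> has_vector_derivative A *v \<xi> s + (B ** Kc) *v X i)
      (at s within {t i..t (Suc i)})" if "s \<in> {t i..t (Suc i)}" for s i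
    using has_vector_derivative_transform[OF that \<xi>_eq flow_t[OF that]] \<xi>_eq[OF that] by simp
  have cont: "continuous_on {0..t n} \<xi>" for n
  proof (induction n)
    case (Suc n)
    have "{0..t (Suc n)} = {0..t n} \<union> {t n..t (Suc n)}"
      using t_less[of n] t_nonneg[of n] by auto
    moreover have "continuous_on {t n..t (Suc n)} \<xi>"
      by (rule continuous_on_vector_derivative[OF \<xi>_deriv])
    ultimately show ?case using Suc by (simp add: continuous_on_closed_Un)
  qed (simp add: t_0)
  have "solution t \<xi> (\<lambda>s. X (idx s))"
    unfolding petc_solution_def
  proof (intro conjI allI ballI)
    show "continuous_on {0..} \<xi>"
      unfolding continuous_on_eq_continuous_within
    proof
      fix s :: real assume s: "s \<in> {0..}"
      obtain n where n: "s < t n" using t_unbounded by blast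
      have within: "at s within {0..t n} = at s within {0..}"
        using n by (intro at_within_nhd[of s "{..<t n}"]) auto
      have "continuous (at s within {0..t n}) \<xi>"
        using cont[of n] s n unfolding continuous_on_eq_continuous_within by simp
      then show "continuous (at s within {0..}) \<xi>" unfolding within .
    qed
  next
    fix i s assume s: "s \<in> {t i..<t (Suc i)}"
    then show "X (idx s) = \<xi> (t i)" by (simp add: idx_eq \<xi>_t)
    show "(\<xi> has_vector_derivative A *v \<xi> s + (B ** Kc) *v X (idx s))
        (at s within {t i..<t (Suc i)})"
      unfolding idx_eq[OF s]
      by (rule has_vector_derivative_within_subset[OF \<xi>_deriv]) (use s in auto)
  qed (use t_0 t_Suc \<xi>_t in auto)
  moreover have "\<xi> 0 = x" using \<xi>_t[of 0] by (simp add: t_0 X_def)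
  ultimately show ?thesis by (rule that)
qed

end

section \<open>Contraction and decay rate\<close>

lemma sqrt_power_eq_exp:
  assumes "0 < r"
  shows "sqrt (r ^ n) = exp (real n * ln r / 2)"
proof (rule real_sqrt_unique)
  have "(exp (real n * ln r / 2))\<^sup>2 = exp (real n * ln r)"
    by (simp flip: exp_double)
  also have "\<dots> = r ^ n" using assms by (simp add: exp_of_nat_mult)
  finally show "(exp (real n * ln r / 2))\<^sup>2 = r ^ n" .
qed simp

text \<open>Powers of a base below 1 decrease in the exponent, so rounding \<open>log a r\<close> up
  preserves the bound.\<close>

lemma power_Nlen_le:
  assumes "0 < r" "r < 1" "0 \<le> a" "a < 1"
  shows "a ^ Nlen a r \<le> r"
proof (cases "a = 0")
  \<comment> \<open>\<open>Nlen\<close> has its separate value 1 here, and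
    \<open>0 ^ 1 = 0\<close>.\<close>
  case True
  then show ?thesis using assms by (simp add: Nlen_def)
next
  case False
  with assms have a: "0 < a" by simp
  have "log a r \<le> real (Nlen a r)"
    using False by (simp add: Nlen_def of_nat_ceiling)
  then have "a powr real (Nlen a r) \<le> a powr log a r"
    using a assms by (intro powr_mono') auto
  then show ?thesis using a assms by (simp add: powr_realpow)
qed

lemma finite_seqs: "finite K \<Longrightarrow> finite (seqs K N)"
  by (simp add: seqs_def finite_lists_length_eq)

text \<open>\<open>l\<close> is the minimum of the form on the compact unit sphere, attained and
  hence positive; homogeneity extends the bound to all vectors.\<close>

lemma pos_definite_lower_bound:
  fixes P :: "real ^ 'n ^ 'n"
  assumes "pos_definite P"
  obtains l where "0 < l" "\<And>x. l * (norm x)\<^sup>2 \<le> qform P x"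
proof -
  let ?S = "sphere 0 1 :: (real ^ 'n) set"
  have "axis undefined 1 \<in> ?S" by simp
  then have "?S \<noteq> {}" by blast
  moreover have "continuous_on ?S (qform P)"
    unfolding qform_def by (intro continuous_intros linear_continuous_on) simp
  ultimately obtain y where y: "y \<in> ?S" "\<And>x. x \<in> ?S \<Longrightarrow> qform P y \<le> qform P x"
    using continuous_attains_inf[OF compact_sphere] by blast
  show ?thesis
  proof
    have "y \<noteq> 0" using y(1) by auto
    then show "0 < qform P y" using assms by (simp add: pos_definite_def)
    fix x :: "real ^ 'n"
    show "qform P y * (norm x)\<^sup>2 \<le> qform P x"
    proof (cases "x = 0")
      case False
      then have "qform P y \<le> qform P (x /\<^sub>R norm x)" by (intro y) simp
      with False show ?thesis by (simp add: qform_scaleR divide_simps)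
    qed (simp add: qform_def)
  qed
qed

lemma qform_upper_bound:
  fixes P :: "real ^ 'n ^ 'n"
  obtains u where "0 \<le> u" "\<And>x. qform P x \<le> u * (norm x)\<^sup>2"
proof
  show "0 \<le> onorm ((*v) P)" by (simp add: onorm_pos_le)
  fix x
  have "qform P x \<le> norm x * norm (P *v x)"
    unfolding qform_def by (rule norm_cauchy_schwarz)
  also have "\<dots> \<le> norm x * (onorm ((*v) P) * norm x)"
    by (intro mult_left_mono onorm) auto
  finally show "qform P x \<le> onorm ((*v) P) * (norm x)\<^sup>2"
    by (simp add: power2_eq_square mult_ac)
qed

locale contractive_petc = petc A B Kc Q h kbar
  for A :: "real ^ 'x ^ 'x" and B :: "real ^ 'u ^ 'x" and Kc :: "real ^ 'x ^ 'u"
    and Q :: "real ^ ('x + 'x) ^ ('x + 'x)" and h :: real and kbar :: nat +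
  fixes P :: "real ^ 'x ^ 'x" and a r :: real
  assumes P_pos: "pos_definite P"
    and r_pos: "0 < r" and r_less_1: "r < 1"
    and a_nonneg: "0 \<le> a" and a_less_1: "a < 1"
    and contraction: "\<And>x. qform P (step x) \<le> a * qform P x"
begin

section \<open>Contraction by the factor \<open>r\<close> within time \<open>T\<close>\<close>

abbreviation T where "T \<equiv> T_star A B Kc Q h kbar P a r"

lemma qform_P_nonneg: "0 \<le> qform P x"
  using P_pos by (cases "x = 0") (auto simp: pos_definite_def qform_def less_imp_le)

lemma contraction_power: "qform P ((step ^^ n) x) \<le> a ^ n * qform P x"
proof (induction n)
  case (Suc n)
  have "qform P ((step ^^ Suc n) x) \<le> a * qform P ((step ^^ n) x)"
    using contraction by simp
  also have "\<dots> \<le> a * (a ^ n * qform P x)"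
    by (intro mult_left_mono Suc a_nonneg)
  finally show ?case by (simp add: mult.assoc)
qed simp

lemma qform_P_step_le: "qform P ((step ^^ n) x) \<le> qform P x"
proof -
  have "a ^ n * qform P x \<le> 1 * qform P x"
    using a_nonneg a_less_1 qform_P_nonneg by (intro mult_right_mono power_le_one) auto
  with contraction_power[of n x] show ?thesis by simp
qed

text \<open>\<open>kappa x\<close> is the first index at which the trigger condition holds, so the
  condition fails at every index that \<open>Qset\<close> excludes; these start at
  \<open>kmin\<close>, which is at least 1.\<close>

lemma Qset_kappa:
  assumes "qform P x \<le> 1"
  shows "x \<in> Qset A B Kc Q h kbar P (kappa x)"
proof -
  have "x \<in> Kset A B Kc Q h kbar P (kappa x)"
    using assms kappa_mem[of x] by (auto simp: Kset_def sublevel_def)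
  moreover have "x \<notin> Kset A B Kc Q h kbar P j" if "kmin A B Kc Q h kbar \<le> j" "j < kappa x" for j
  proof -
    have "qform (Nmat A B Kc Q h j) x \<le> 0"
      using that kmin_ge_1 by (intro qform_Nmat_before_event) auto
    moreover have "j < kbar" using that(2) kappa_bounds(2)[of x] by simp
    ultimately show ?thesis by (simp add: Kset_def)
  qed
  ultimately show ?thesis by (simp add: Qset_def)
qed

lemma finite_X_S': "finite (X_S' A B Kc Q h kbar P a r)"
  by (rule finite_subset[OF _ finite_seqs[OF finite_atLeastAtMost]]) (auto simp: X_S'_def)

text \<open>Dividing by \<open>qform P x\<close> turns the thresholds \<open>r * qform P x\<close>
  into the level \<open>r\<close> for the normalised state, and scaling leaves the events
  unchanged.\<close>

lemma events_in_X_S':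
  assumes x: "x \<noteq> 0" and n: "1 \<le> n" "n \<le> Nlen a r"
    and before: "\<And>i. i < n \<Longrightarrow> r * qform P x < qform P ((step ^^ i) x)"
    and at: "qform P ((step ^^ n) x) \<le> r * qform P x"
  shows "events n x \<in> X_S' A B Kc Q h kbar P a r"
proof -
  have V: "0 < qform P x" using P_pos x by (simp add: pos_definite_def)
  \<comment> \<open>The factor by which \<open>R_S'\<close> scales \<open>x\<close>, named so that
    \<open>c_def\<close> can be folded in its definition.\<close>
  define c where "c = inverse (sqrt (qform P x))"
  have c: "c \<noteq> 0" "c\<^sup>2 = inverse (qform P x)"
    using V by (auto simp: c_def power_inverse)
  have scaled: "qform P (c *\<^sub>R (step ^^ i) x) = qform P ((step ^^ i) x) / qform P x" for i
    using c by (simp add: qform_scaleR divide_inverse mult.commute)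
  have run: "run A B Kc h (c *\<^sub>R x) (take i (events n x)) = c *\<^sub>R (step ^^ i) x"
    if "i \<le> n" for i
    using that by (simp add: take_events run_events)
  have le_1: "qform P (c *\<^sub>R (step ^^ i) x) \<le> 1" for i
    using V qform_P_step_le[of i x] by (simp add: scaled)
  have gt_r: "r < qform P (c *\<^sub>R (step ^^ i) x)" if "i < n" for i
    using V before[OF that] by (simp add: scaled field_simps)
  have le_r: "qform P (c *\<^sub>R (step ^^ n) x) \<le> r"
    using V at by (simp add: scaled field_simps)
  have Qset: "c *\<^sub>R (step ^^ i) x \<in> Qset A B Kc Q h kbar P (events n x ! i)" if "i < n" for i
    using Qset_kappa[OF le_1[of i]] that by (simp add: kappa_scaleR c events_def)
  have seqs: "events n x \<in> seqs {kmin A B Kc Q h kbar..kbar} (Nlen a r)"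
    using n kmin_le_kappa kappa_bounds(2) by (auto simp: seqs_def events_def)
  have "(x, events n x) \<in> R_S' A B Kc Q h kbar P a r"
    unfolding R_S'_def Let_def mem_Collect_eq case_prod_conv c_def[symmetric]
  proof (intro conjI allI impI)
    show "c *\<^sub>R x \<in> sublevel P 1" using le_1[of 0] by (simp add: sublevel_def)
    show "c *\<^sub>R x \<notin> sublevel P r" using gt_r[of 0] n by (simp add: sublevel_def)
    show "run A B Kc h (c *\<^sub>R x) (events n x) \<in> sublevel P r"
      using le_r by (simp add: run_events sublevel_def)
    fix i assume "i < length (events n x)"
    then have i: "i < n" by simp
    then show "run A B Kc h (c *\<^sub>R x) (take i (events n x)) \<in> Qset A B Kc Q h kbar P (events n x ! i)"
      using Qset[OF i] by (simp add: run)
    show "run A B Kc h (c *\<^sub>R x) (take i (events n x)) \<notin> sublevel P r"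
      using gt_r[OF i] i by (simp add: run sublevel_def)
  qed (rule seqs)
  with seqs show ?thesis unfolding X_S'_def by blast
qed

lemma contraction_within_T:
  assumes "x \<noteq> 0"
  obtains n where "1 \<le> n" "qform P ((step ^^ n) x) \<le> r * qform P x"
    "h * real (sum_list (events n x)) \<le> T"
proof -
  let ?p = "\<lambda>n. qform P ((step ^^ n) x) \<le> r * qform P x"
  \<comment> \<open>Minimality keeps all earlier iterates above the threshold, and
    \<open>Nlen a r\<close> is a candidate, which bounds the length.\<close>
  define n where "n = (LEAST n. ?p n)"
  have "qform P ((step ^^ Nlen a r) x) \<le> a ^ Nlen a r * qform P x"
    by (rule contraction_power)
  also have "\<dots> \<le> r * qform P x"
    using power_Nlen_le r_pos r_less_1 a_nonneg a_less_1 qform_P_nonneg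
    by (intro mult_right_mono) auto
  finally have Nlen: "?p (Nlen a r)" .
  have p: "?p n" unfolding n_def by (rule LeastI[of ?p, OF Nlen])
  have "0 < qform P x" using P_pos assms by (simp add: pos_definite_def)
  \<comment> \<open>Excludes the empty sequence, which is related to no state.\<close>
  then have "\<not> ?p 0" using r_less_1 by simp
  with p have "n \<noteq> 0" by metis
  then have "1 \<le> n" by simp
  moreover have "n \<le> Nlen a r" unfolding n_def by (rule Least_le[of ?p, OF Nlen])
  moreover have "r * qform P x < qform P ((step ^^ i) x)" if "i < n" for i
    using not_less_Least[of i ?p] that by (simp add: n_def)
  ultimately have "events n x \<in> X_S' A B Kc Q h kbar P a r"
    using p assms by (intro events_in_X_S')
  then have "sum_list (events n x) \<le> Max (sum_list ` X_S' A B Kc Q h kbar P a r)"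
    by (intro Max_ge finite_imageI finite_X_S') auto
  then have "h * real (sum_list (events n x)) \<le> T"
    using h_pos by (simp add: T_star_def)
  with p \<open>1 \<le> n\<close> show ?thesis by (intro that)
qed

text \<open>Any nonzero state yields an element of \<open>X_S'\<close> with at least one event, and
  every inter-event time is at least \<open>h\<close>. In particular, the maximum in
  \<open>T\<close> is over a nonempty set.\<close>

lemma T_pos: "0 < T"
proof -
  have "axis undefined 1 \<noteq> (0 :: real ^ 'x)" (is "?x \<noteq> 0") by (simp add: axis_eq_0_iff)
  then obtain n where n: "1 \<le> n" "h * real (sum_list (events n ?x)) \<le> T"
    by (rule contraction_within_T)
  moreover have "0 < h * real (sum_list (events n ?x))"
    using h_pos n sum_list_events_ge[of n ?x] by simp
  ultimately show ?thesis by linarith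
qed

lemma contraction_within_multiple_T:
  "\<exists>i. qform P ((step ^^ i) x) \<le> r ^ n * qform P x \<and> h * real (sum_list (events i x)) \<le> n * T"
proof (induction n)
  case 0
  show ?case by (rule exI[of _ 0]) (simp add: events_def)
next
  case (Suc n)
  then obtain i where i: "qform P ((step ^^ i) x) \<le> r ^ n * qform P x"
    "h * real (sum_list (events i x)) \<le> n * T" by blast
  let ?y = "(step ^^ i) x"
  show ?case
  \<comment> \<open>At the zero state \<open>contraction_within_T\<close> does not apply, but a
    vanishing form meets every later bound, so the same \<open>i\<close> serves and only the time
    allowance grows.\<close>
  proof (cases "?y = 0")
    case True
    then have "qform P ?y \<le> r ^ Suc n * qform P x"
      using r_pos qform_P_nonneg[of x] by (simp add: qform_def)
    moreover have "h * real (sum_list (events i x)) \<le> real (Suc n) * T"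
      using i(2) T_pos by (simp add: distrib_right)
    ultimately show ?thesis by blast
  next
    case False
    then obtain m where m: "qform P ((step ^^ m) ?y) \<le> r * qform P ?y"
      "h * real (sum_list (events m ?y)) \<le> T"
      by (rule contraction_within_T)
    have "(step ^^ (i + m)) x = (step ^^ m) ?y"
      by (simp add: funpow_add add.commute[of i m])
    moreover have "r * qform P ?y \<le> r * (r ^ n * qform P x)"
      using i(1) r_pos by simp
    ultimately have "qform P ((step ^^ (i + m)) x) \<le> r ^ Suc n * qform P x"
      using m(1) by simp
    moreover have "h * real (sum_list (events (i + m) x)) \<le> real (Suc n) * T"
      using m(2) i(2) by (simp add: events_add distrib_right distrib_left)
    ultimately show ?thesis by blast
  qed
qed

section \<open>From decay of the quadratic form to decay of the norm\<close>

lemma norm_le_of_qform_decay: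
  assumes "0 < l" "\<And>x. l * (norm x)\<^sup>2 \<le> qform P x"
    and "0 \<le> u" "\<And>x. qform P x \<le> u * (norm x)\<^sup>2"
    and "qform P y \<le> r ^ n * qform P x"
  shows "norm y \<le> sqrt (u / l) * exp (n * ln r / 2) * norm x"
proof -
  have "l * (norm y)\<^sup>2 \<le> qform P y" by (rule assms(2))
  also note assms(5)
  also have "r ^ n * qform P x \<le> r ^ n * (u * (norm x)\<^sup>2)"
    using r_pos by (intro mult_left_mono assms(4)) simp
  finally have "l * (norm y)\<^sup>2 \<le> r ^ n * (u * (norm x)\<^sup>2)" .
  then have "(norm y)\<^sup>2 \<le> (u / l) * r ^ n * (norm x)\<^sup>2"
    using assms(1) by (simp add: field_simps)
  \<comment> \<open>The square root halves the exponent, which is the origin of the 2 in the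
    rate.\<close>
  then have "norm y \<le> sqrt ((u / l) * r ^ n * (norm x)\<^sup>2)"
    by (rule real_le_rsqrt)
  also have "\<dots> = sqrt (u / l) * sqrt (r ^ n) * norm x"
    unfolding real_sqrt_mult by simp
  finally show ?thesis using r_pos by (simp add: sqrt_power_eq_exp)
qed

lemma decay_rate_estimate_T:
  assumes "GES A B Kc Q h kbar"
  shows "decay_rate_estimate A B Kc Q h kbar (- ln r / (2 * T))"
proof -
  obtain b where "decay_rate_estimate A B Kc Q h kbar b"
    using assms unfolding GES_def ..
  then obtain C where b: "b > 0" and C: "\<forall>t \<xi> \<xi>h. solution t \<xi> \<xi>h \<longrightarrow>
      (\<forall>s\<ge>0. norm (\<xi> s) \<le> C * exp (- b * s) * norm (\<xi> 0))"
    unfolding decay_rate_estimate_def by (elim conjE exE)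
  \<comment> \<open>The form in which GES is applied after an event: the exponential is at most 1,
    and the maximum with 0 gives a nonnegative constant.\<close>
  have C': "norm (\<xi> s) \<le> max C 0 * norm (\<xi> 0)" if "solution t \<xi> \<xi>h" "0 \<le> s" for t \<xi> \<xi>h s
  proof -
    have "C * exp (- b * s) \<le> max C 0 * exp (- b * s)" by (intro mult_right_mono) auto
    also have "\<dots> \<le> max C 0 * 1" using b that by (intro mult_left_mono) auto
    finally show ?thesis
      using C[rule_format, OF that]
        mult_right_mono[of "C * exp (- b * s)" "max C 0" "norm (\<xi> 0)"]
      by simp
  qed
  obtain l where l: "0 < l" "\<And>x. l * (norm x)\<^sup>2 \<le> qform P x"
    using pos_definite_lower_bound[OF P_pos] by blast
  obtain u where u: "0 \<le> u" "\<And>x. qform P x \<le> u * (norm x)\<^sup>2"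
    using qform_upper_bound[of P] by blast
  let ?D = "max C 0 * sqrt (u / l)"
  have D: "0 \<le> ?D" using l u by simp
  \<comment> \<open>The factor \<open>exp (- ln r / 2)\<close>, that is \<open>1 / sqrt r\<close>,
    pays for rounding \<open>s / T\<close> down.\<close>
  have "norm (\<xi> s) \<le> ?D * exp (- ln r / 2) * exp (- (- ln r / (2 * T)) * s) * norm (\<xi> 0)"
    if sol: "solution t \<xi> \<xi>h" and s: "0 \<le> s" for t \<xi> \<xi>h s
  proof -
    define n where "n = nat \<lfloor>s / T\<rfloor>"
    have "0 \<le> s / T" using s T_pos by simp
    then have n: "real n \<le> s / T" "s / T - 1 \<le> real n"
      unfolding n_def by linarith+
    \<comment> \<open>Event \<open>i\<close> shows \<open>n\<close> contractions and occurs no later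
      than \<open>n * T\<close>, hence by time \<open>s\<close>. It need not be the last event
      before \<open>s\<close>; the uniform bound covers the rest.\<close>
    obtain i where i: "qform P ((step ^^ i) (\<xi> 0)) \<le> r ^ n * qform P (\<xi> 0)"
      "h * real (sum_list (events i (\<xi> 0))) \<le> n * T"
      using contraction_within_multiple_T by blast
    have t_le: "t i \<le> s"
      using i(2) n(1) T_pos by (simp add: solution_time[OF sol] field_simps)
    have "norm (\<xi> s) \<le> max C 0 * norm (\<xi> (t i))"
      using C'[OF solution_shift[OF sol, of i], of "s - t i"] t_le by simp
    also have "\<dots> \<le> max C 0 * (sqrt (u / l) * exp (n * ln r / 2) * norm (\<xi> 0))"
      using norm_le_of_qform_decay[OF l u i(1)]
      by (intro mult_left_mono) (auto simp: solution_state[OF sol])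
    also have "\<dots> = ?D * exp (n * ln r / 2) * norm (\<xi> 0)" by simp
    also have "\<dots> \<le> ?D * (exp (- ln r / 2) * exp (- (- ln r / (2 * T)) * s)) * norm (\<xi> 0)"
    proof (intro mult_right_mono mult_left_mono D norm_ge_zero)
      \<comment> \<open>The negative factor \<open>ln r\<close> turns the lower bound on
        \<open>n\<close> into an upper bound.\<close>
      have "exp (n * ln r / 2) \<le> exp ((s / T - 1) * ln r / 2)"
        using n(2) r_pos r_less_1 by (simp add: mult_right_mono_neg divide_right_mono)
      also have "\<dots> = exp (- ln r / 2) * exp (- (- ln r / (2 * T)) * s)"
        by (simp add: field_simps flip: exp_add)
      finally show "exp (n * ln r / 2) \<le> exp (- ln r / 2) * exp (- (- ln r / (2 * T)) * s)" .
    qed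
    finally show ?thesis by (simp only: mult.assoc)
  qed
  moreover have "0 < - ln r / (2 * T)" using r_pos r_less_1 T_pos by (simp add: divide_neg_pos)
  ultimately show ?thesis unfolding decay_rate_estimate_def by blast
qed

end

theorem proposition5:
  fixes A :: "real ^ 'x ^ 'x" and B :: "real ^ 'u ^ 'x" and Kc :: "real ^ 'x ^ 'u"
    and Q :: "real ^ ('x + 'x) ^ ('x + 'x)" and P :: "real ^ 'x ^ 'x"
    and h a r :: real and kbar :: nat
  assumes "h > 0" and "kbar \<ge> 1"
    and "symmetric_matrix Q"
    and "symmetric_matrix P" and "pos_definite P"
    and "0 < r" and "r < 1"
    and "GES A B Kc Q h kbar"
    and "0 \<le> a" and "a < 1"
    and "\<And>t \<xi> \<xi>h i. petc_solution A B Kc Q h kbar t \<xi> \<xi>h \<Longrightarrow>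
           qform P (\<xi> (t (Suc i))) \<le> a * qform P (\<xi> (t i))"
  shows "decay_rate_estimate A B Kc Q h kbar (- ln r / (2 * T_star A B Kc Q h kbar P a r))"
proof -
  interpret petc A B Kc Q h kbar by unfold_locales fact+
  \<comment> \<open>Every state starts some solution, so the assumed contraction, read at the first
    event, holds for \<open>step\<close> at every state.\<close>
  have step: "qform P (step x) \<le> a * qform P x" for x
  proof -
    obtain t \<xi> \<xi>h where sol: "solution t \<xi> \<xi>h" "\<xi> 0 = x" by (rule solution_exists)
    show ?thesis
      using assms(11)[OF sol(1), of 0] by (simp add: solution_state[OF sol(1)] sol(2))
  qed
  interpret contractive_petc A B Kc Q h kbar P a r
    by unfold_locales (fact assms step)+
  show ?thesis by (rule decay_rate_estimate_T) fact
qed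

end
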